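(* Consider the one-dimensional Bratu problem $u''(x)+\lambda e^{u(x)}=0$ for $x\in[-1,1]$, $u(-1)=u(1)=0$, with parameter $\lambda\in\mathbb{R}$, and its primary path of non-trivial solutions $\{(u_0(\cdot,\alpha),\lambda_0(\alpha)) : \alpha>0\}$, where $$u_0(x,\alpha)=-2\ln\left[\frac{\cosh(\alpha x)}{\cosh(\alpha)}\right],\qquad \lambda_0(\alpha)=2\left[\frac{\alpha}{\cosh(\alpha)}\right]^2 .$$ There is exactly one critical point on this path, and it is a limit (turning) point. There are no bifurcation points on this path.
   Context: Let $X=\{u\in C^2([-1,1]) : u(-1)=u(1)=0\}$ with the $C^2$ norm and let $F:X\times\mathbb{R}\to C([-1,1])$, $F(u,\lambda)=u''+\lambda e^{u}$. Then $D_uF(u,\lambda)w=w''+\lambda e^{u}w$ for $w\in X$ and $D_\lambda F(u,\lambda)=e^{u}$. A point $(u_0(\cdot,\alpha),\lambda_0(\alpha))$ with $\alpha>0$ is a critical point if there is a non-trivial $w\in X$ with $D_uF(u_0(\cdot,\alpha),\lambda_0(\alpha))w=0$, i.e. $w''+2\left[\frac{\alpha}{\cosh(\alpha x)}\right]^2w=0$ on $[-1,1]$, $w(\pm1)=0$. A critical point $(u_0,\lambda_0)$ is a limit (turning) point if the kernel of $D_uF(u_0,\lambda_0)$ is one-dimensional and $D_\lambda F(u_0,\lambda_0)$ does not belong to the range of $D_uF(u_0,\lambda_0)$. Bifurcation means branching of solutions: a point of the path is a bifurcation point if every neighbourhood of it in $X\times\mathbb{R}$ contains a solution $(u,\lambda)$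 of $F(u,\lambda)=0$ that does not lie on the path. *)

theory Defs
  imports "HOL-Analysis.Analysis"
begin

section \<open>The space of continuous functions on \<open>[-1,1]\<close> with the sup norm\<close>

text \<open>Functions on \<open>[-1,1]\<close> are represented by functions on the reals that vanish outside the
  interval, so that equality of representatives is equality on \<open>[-1,1]\<close>. All continuity and
  differentiability conditions are relative to \<open>[-1,1]\<close>, i.e. one-sided at the end points, hence
  insensitive to this extension.\<close>

abbreviation Ivl :: "real set" where "Ivl \<equiv> {-1..1}"

typedef C0 = "{f :: real \<Rightarrow> real. continuous_on Ivl f \<and> (\<forall>x. x \<notin> Ivl \<longrightarrow> f x = 0)}"
  morphisms C0_apply Abs_C0
  by (rule exI[of _ "\<lambda>_. 0"]) simp

setup_lifting type_definition_C0

lemma C0_eqI: "(\<And>x. x \<in> Ivl \<Longrightarrow> C0_apply f x = C0_apply g x) \<Longrightarrow> f = g"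
  by transfer (fastforce simp: fun_eq_iff)

instantiation C0 :: real_vector
begin
lift_definition zero_C0 :: C0 is "\<lambda>_. 0" by simp
lift_definition plus_C0 :: "C0 \<Rightarrow> C0 \<Rightarrow> C0" is "\<lambda>f g x. f x + g x"
  by (auto intro!: continuous_intros)
lift_definition minus_C0 :: "C0 \<Rightarrow> C0 \<Rightarrow> C0" is "\<lambda>f g x. f x - g x"
  by (auto intro!: continuous_intros)
lift_definition uminus_C0 :: "C0 \<Rightarrow> C0" is "\<lambda>f x. - f x"
  by (auto intro!: continuous_intros)
lift_definition scaleR_C0 :: "real \<Rightarrow> C0 \<Rightarrow> C0" is "\<lambda>c f x. c * f x"
  by (auto intro!: continuous_intros)
instance
  by standard (transfer; simp add: fun_eq_iff algebra_simps)+
end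

lemma C0_bdd: "bdd_above ((\<lambda>x. \<bar>C0_apply f x\<bar>) ` Ivl)"
proof -
  have "compact ((\<lambda>x. \<bar>C0_apply f x\<bar>) ` Ivl)"
    using C0_apply[of f] by (intro compact_continuous_image continuous_intros) auto
  then show ?thesis
    by (simp add: bounded_imp_bdd_above compact_imp_bounded)
qed

instantiation C0 :: real_normed_vector
begin
definition norm_C0 :: "C0 \<Rightarrow> real" where "norm_C0 f = (SUP x\<in>Ivl. \<bar>C0_apply f x\<bar>)"
definition sgn_C0 :: "C0 \<Rightarrow> C0" where "sgn_C0 f = f /\<^sub>R norm f"
definition dist_C0 :: "C0 \<Rightarrow> C0 \<Rightarrow> real" where "dist_C0 f g = norm (f - g)"
definition uniformity_C0 :: "(C0 \<times> C0) filter"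
  where "uniformity_C0 = (INF e\<in>{0<..}. principal {(x, y). dist x y < e})"
definition open_C0 :: "C0 set \<Rightarrow> bool"
  where "open_C0 U \<longleftrightarrow> (\<forall>x\<in>U. \<forall>\<^sub>F (x', y) in uniformity. x' = x \<longrightarrow> y \<in> U)"

lemma C0_apply_le_norm: "\<bar>C0_apply f x\<bar> \<le> norm (f :: C0)"
proof (cases "x \<in> Ivl")
  case True
  then show ?thesis unfolding norm_C0_def by (intro cSUP_upper C0_bdd)
next
  case False
  have "\<bar>C0_apply f 0\<bar> \<le> norm f" unfolding norm_C0_def by (intro cSUP_upper C0_bdd) simp
  then show ?thesis using False C0_apply[of f] by auto
qed

lemma norm_C0_le: "(\<And>x. x \<in> Ivl \<Longrightarrow> \<bar>C0_apply f x\<bar> \<le> c) \<Longrightarrow> norm (f :: C0) \<le> c"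
  unfolding norm_C0_def by (rule cSUP_least) auto

instance
proof
  fix f g :: C0 and c :: real
  show "norm f = 0 \<longleftrightarrow> f = 0"
  proof
    assume "norm f = 0"
    then have "C0_apply f x = 0" for x using C0_apply_le_norm[of f x] by simp
    then show "f = 0" by (intro C0_eqI) (simp add: zero_C0.rep_eq)
  qed (simp add: norm_C0_def zero_C0.rep_eq)
  show "norm (f + g) \<le> norm f + norm g"
  proof (rule norm_C0_le)
    fix x
    show "\<bar>C0_apply (f + g) x\<bar> \<le> norm f + norm g"
      using C0_apply_le_norm[of f x] C0_apply_le_norm[of g x] by (simp add: plus_C0.rep_eq)
  qed
  show "norm (c *\<^sub>R f) = \<bar>c\<bar> * norm f"
  proof (rule antisym)
    show "norm (c *\<^sub>R f) \<le> \<bar>c\<bar> * norm f"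
      by (rule norm_C0_le)
        (simp add: scaleR_C0.rep_eq abs_mult mult_left_mono C0_apply_le_norm)
    show "\<bar>c\<bar> * norm f \<le> norm (c *\<^sub>R f)"
    proof (cases "c = 0")
      case True
      then show ?thesis using C0_apply_le_norm[of "c *\<^sub>R f" 0] by simp
    next
      case False
      have "norm f \<le> norm (c *\<^sub>R f) / \<bar>c\<bar>"
      proof (rule norm_C0_le)
        fix x
        show "\<bar>C0_apply f x\<bar> \<le> norm (c *\<^sub>R f) / \<bar>c\<bar>"
          using False C0_apply_le_norm[of "c *\<^sub>R f" x]
          by (simp add: scaleR_C0.rep_eq abs_mult field_simps)
      qed
      then show ?thesis using False by (simp add: field_simps)
    qed
  qed
qed (simp_all add: sgn_C0_def dist_C0_def uniformity_C0_def open_C0_def)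
end

section \<open>The space \<open>X\<close> with the \<open>C\<^sup>2\<close> norm\<close>

definition ivl_deriv :: "(real \<Rightarrow> real) \<Rightarrow> real \<Rightarrow> real" where
  "ivl_deriv f x = (if x \<in> Ivl then vector_derivative f (at x within Ivl) else 0)"

definition C2_on_Ivl :: "(real \<Rightarrow> real) \<Rightarrow> bool" where
  "C2_on_Ivl u \<longleftrightarrow> u differentiable_on Ivl \<and> ivl_deriv u differentiable_on Ivl \<and>
     continuous_on Ivl (ivl_deriv (ivl_deriv u))"

lemma ivl_deriv_eq:
  assumes "(f has_real_derivative d) (at x within Ivl)" "x \<in> Ivl"
  shows "ivl_deriv f x = d"
  using assms vector_derivative_within_closed_interval[of "-1" 1 x f d]
  by (simp add: ivl_deriv_def has_real_derivative_iff_has_vector_derivative)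

lemma ivl_deriv_works:
  assumes "f differentiable_on Ivl" "x \<in> Ivl"
  shows "(f has_real_derivative ivl_deriv f x) (at x within Ivl)"
  using assms ivl_deriv_eq unfolding differentiable_on_def real_differentiable_def by metis

lemma ivl_deriv_outside: "x \<notin> Ivl \<Longrightarrow> ivl_deriv f x = 0"
  by (simp only: ivl_deriv_def if_False)

lemma ivl_derivI:
  assumes "\<And>x. x \<in> Ivl \<Longrightarrow> (f has_real_derivative g x) (at x within Ivl)"
    "\<And>x. x \<notin> Ivl \<Longrightarrow> g x = 0"
  shows "f differentiable_on Ivl" "ivl_deriv f = g"
proof -
  show "f differentiable_on Ivl"
    using assms(1) unfolding differentiable_on_def real_differentiable_def by blast
  show "ivl_deriv f = g"
  proof
    fix x show "ivl_deriv f x = g x"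
      using assms ivl_deriv_eq[of f "g x" x] ivl_deriv_outside[of x f] by (cases "x \<in> Ivl") auto
  qed
qed

lemma ivl_deriv_lincomb:
  assumes "f differentiable_on Ivl" "g differentiable_on Ivl"
  shows "(\<lambda>x. a * f x + b * g x) differentiable_on Ivl"
    "ivl_deriv (\<lambda>x. a * f x + b * g x) = (\<lambda>x. a * ivl_deriv f x + b * ivl_deriv g x)"
proof -
  have *: "((\<lambda>x. a * f x + b * g x) has_real_derivative a * ivl_deriv f x + b * ivl_deriv g x)
      (at x within Ivl)" if "x \<in> Ivl" for x
    by (intro derivative_intros DERIV_cmult ivl_deriv_works assms that)
  have **: "a * ivl_deriv f x + b * ivl_deriv g x = 0" if "x \<notin> Ivl" for x
    by (simp only: ivl_deriv_outside[OF that])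
  show "(\<lambda>x. a * f x + b * g x) differentiable_on Ivl"
    using * ** by (rule ivl_derivI(1))
  show "ivl_deriv (\<lambda>x. a * f x + b * g x) = (\<lambda>x. a * ivl_deriv f x + b * ivl_deriv g x)"
    using * ** by (rule ivl_derivI(2))
qed

lemma C2_on_Ivl_lincomb:
  assumes "C2_on_Ivl f" "C2_on_Ivl g"
  shows "C2_on_Ivl (\<lambda>x. a * f x + b * g x)"
  using assms unfolding C2_on_Ivl_def
  by (auto simp: ivl_deriv_lincomb intro!: continuous_intros)

lemma C2_on_Ivl_zero: "C2_on_Ivl (\<lambda>_. 0)"
proof -
  have "ivl_deriv (\<lambda>_. 0) = (\<lambda>_. 0)" by (rule ivl_derivI) auto
  then show ?thesis by (simp add: C2_on_Ivl_def)
qed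

typedef X = "{u :: real \<Rightarrow> real. C2_on_Ivl u \<and> u (-1) = 0 \<and> u 1 = 0 \<and> (\<forall>x. x \<notin> Ivl \<longrightarrow> u x = 0)}"
  morphisms X_apply Abs_X
  by (rule exI[of _ "\<lambda>_. 0"]) (simp add: C2_on_Ivl_zero)

setup_lifting type_definition_X

lift_definition X_val :: "X \<Rightarrow> C0" is "\<lambda>u. u"
  by (auto simp: C2_on_Ivl_def intro: differentiable_imp_continuous_on)
lift_definition X_d1 :: "X \<Rightarrow> C0" is "ivl_deriv"
  by (auto simp: C2_on_Ivl_def ivl_deriv_outside intro: differentiable_imp_continuous_on)
lift_definition X_d2 :: "X \<Rightarrow> C0" is "\<lambda>u. ivl_deriv (ivl_deriv u)"
  by (auto simp: C2_on_Ivl_def ivl_deriv_outside)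

instantiation X :: real_vector
begin
lift_definition zero_X :: X is "\<lambda>_. 0" by (simp add: C2_on_Ivl_zero)
lift_definition plus_X :: "X \<Rightarrow> X \<Rightarrow> X" is "\<lambda>f g x. f x + g x"
  using C2_on_Ivl_lincomb[of _ _ 1 1] by auto
lift_definition minus_X :: "X \<Rightarrow> X \<Rightarrow> X" is "\<lambda>f g x. f x - g x"
  using C2_on_Ivl_lincomb[of _ _ 1 "-1"] by auto
lift_definition uminus_X :: "X \<Rightarrow> X" is "\<lambda>f x. - f x"
  using C2_on_Ivl_lincomb[of _ _ "-1" 0] by auto
lift_definition scaleR_X :: "real \<Rightarrow> X \<Rightarrow> X" is "\<lambda>c f x. c * f x"
  using C2_on_Ivl_lincomb[of _ _ _ 0] by auto
instance
  by standard (transfer; simp add: fun_eq_iff algebra_simps)+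
end

lemma X_val_linear: "linear X_val"
  by (rule linearI; transfer; simp)

lemma X_d1_linear: "linear X_d1"
proof (rule linearI; transfer)
  fix f g :: "real \<Rightarrow> real"
  assume "C2_on_Ivl f \<and> f (-1) = 0 \<and> f 1 = 0 \<and> (\<forall>x. x \<notin> Ivl \<longrightarrow> f x = 0)"
    "C2_on_Ivl g \<and> g (-1) = 0 \<and> g 1 = 0 \<and> (\<forall>x. x \<notin> Ivl \<longrightarrow> g x = 0)"
  then show "ivl_deriv (\<lambda>x. f x + g x) = (\<lambda>x. ivl_deriv f x + ivl_deriv g x)"
    using ivl_deriv_lincomb(2)[of f g 1 1] by (simp add: C2_on_Ivl_def)
next
  fix c and f :: "real \<Rightarrow> real"
  assume "C2_on_Ivl f \<and> f (-1) = 0 \<and> f 1 = 0 \<and> (\<forall>x. x \<notin> Ivl \<longrightarrow> f x = 0)"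
  then show "ivl_deriv (\<lambda>x. c * f x) = (\<lambda>x. c * ivl_deriv f x)"
    using ivl_deriv_lincomb(2)[of f f c 0] by (simp add: C2_on_Ivl_def)
qed

lemma X_d2_linear: "linear X_d2"
proof (rule linearI; transfer)
  fix f g :: "real \<Rightarrow> real"
  assume "C2_on_Ivl f \<and> f (-1) = 0 \<and> f 1 = 0 \<and> (\<forall>x. x \<notin> Ivl \<longrightarrow> f x = 0)"
    "C2_on_Ivl g \<and> g (-1) = 0 \<and> g 1 = 0 \<and> (\<forall>x. x \<notin> Ivl \<longrightarrow> g x = 0)"
  then show "ivl_deriv (ivl_deriv (\<lambda>x. f x + g x)) =
      (\<lambda>x. ivl_deriv (ivl_deriv f) x + ivl_deriv (ivl_deriv g) x)"
    using ivl_deriv_lincomb(2)[of f g 1 1] ivl_deriv_lincomb(2)[of "ivl_deriv f" "ivl_deriv g" 1 1]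
    by (simp add: C2_on_Ivl_def)
next
  fix c and f :: "real \<Rightarrow> real"
  assume "C2_on_Ivl f \<and> f (-1) = 0 \<and> f 1 = 0 \<and> (\<forall>x. x \<notin> Ivl \<longrightarrow> f x = 0)"
  then show "ivl_deriv (ivl_deriv (\<lambda>x. c * f x)) = (\<lambda>x. c * ivl_deriv (ivl_deriv f) x)"
    using ivl_deriv_lincomb(2)[of f f c 0] ivl_deriv_lincomb(2)[of "ivl_deriv f" "ivl_deriv f" c 0]
    by (simp add: C2_on_Ivl_def)
qed

instantiation X :: real_normed_vector
begin
definition norm_X :: "X \<Rightarrow> real" where
  "norm_X u = norm (X_val u) + norm (X_d1 u) + norm (X_d2 u)"
definition sgn_X :: "X \<Rightarrow> X" where "sgn_X f = f /\<^sub>R norm f"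
definition dist_X :: "X \<Rightarrow> X \<Rightarrow> real" where "dist_X f g = norm (f - g)"
definition uniformity_X :: "(X \<times> X) filter"
  where "uniformity_X = (INF e\<in>{0<..}. principal {(x, y). dist x y < e})"
definition open_X :: "X set \<Rightarrow> bool"
  where "open_X U \<longleftrightarrow> (\<forall>x\<in>U. \<forall>\<^sub>F (x', y) in uniformity. x' = x \<longrightarrow> y \<in> U)"

instance
proof
  fix f g :: X and c :: real
  note lin = X_val_linear X_d1_linear X_d2_linear
  show "norm f = 0 \<longleftrightarrow> f = 0"
  proof
    assume "norm f = 0"
    then have "norm (X_val f) = 0"
      unfolding norm_X_def by (smt (verit) norm_ge_zero)
    then have "X_val f = 0" by simp
    then show "f = 0" by transfer
  qed (simp add: norm_X_def linear_0[OF lin(1)] linear_0[OF lin(2)] linear_0[OF lin(3)])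
  show "norm (f + g) \<le> norm f + norm g"
    using norm_triangle_ineq[of "X_val f" "X_val g"] norm_triangle_ineq[of "X_d1 f" "X_d1 g"]
      norm_triangle_ineq[of "X_d2 f" "X_d2 g"]
    by (simp add: norm_X_def linear_add[OF lin(1)] linear_add[OF lin(2)] linear_add[OF lin(3)])
  show "norm (c *\<^sub>R f) = \<bar>c\<bar> * norm f"
    by (simp add: norm_X_def linear_scale[OF lin(1)] linear_scale[OF lin(2)]
        linear_scale[OF lin(3)] algebra_simps)
qed (simp_all add: sgn_X_def dist_X_def uniformity_X_def open_X_def)
end

section \<open>The Bratu operator and its partial derivatives\<close>

lift_definition C0_exp :: "C0 \<Rightarrow> C0" is "\<lambda>f x. if x \<in> Ivl then exp (f x) else 0"
  by (auto intro!: continuous_intros cong: continuous_on_cong_simp)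

definition bratu_F :: "X \<times> real \<Rightarrow> C0" where
  "bratu_F = (\<lambda>(u, l). X_d2 u + l *\<^sub>R C0_exp (X_val u))"

definition bratu_DuF :: "X \<times> real \<Rightarrow> X \<Rightarrow> C0" where
  "bratu_DuF = (\<lambda>(u, l). frechet_derivative (\<lambda>v. bratu_F (v, l)) (at u))"

definition bratu_DlF :: "X \<times> real \<Rightarrow> C0" where
  "bratu_DlF = (\<lambda>(u, l). vector_derivative (\<lambda>m. bratu_F (u, m)) (at l))"

lemma bratu_F_apply:
  "x \<in> Ivl \<Longrightarrow> C0_apply (bratu_F (u, l)) x =
    ivl_deriv (ivl_deriv (X_apply u)) x + l * exp (X_apply u x)"
  by (simp add: bratu_F_def plus_C0.rep_eq scaleR_C0.rep_eq C0_exp.rep_eq X_d2.rep_eq X_val.rep_eq)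

text \<open>Existence of both derivatives, and their explicit formulas.\<close>

lift_definition C0_mult :: "C0 \<Rightarrow> C0 \<Rightarrow> C0" is "\<lambda>f g x. f x * g x"
  by (auto intro!: continuous_intros)

lemma norm_C0_mult_le: "norm (C0_mult f g) \<le> norm f * norm g"
  by (rule norm_C0_le)
    (simp add: C0_mult.rep_eq abs_mult mult_mono C0_apply_le_norm)

lemma exp_remainder_le:
  fixes h :: real
  assumes "\<bar>h\<bar> \<le> 1"
  shows "\<bar>exp h - 1 - h\<bar> \<le> h\<^sup>2"
proof -
  have "exp h \<le> 1 + h + h\<^sup>2"
  proof (cases "h \<ge> 0")
    case True
    then show ?thesis using exp_bound[of h] assms by simp
  next
    case False
    have "1 \<le> (1 - h) * (1 + h + h\<^sup>2)"
      using False mult_nonneg_nonpos[of "h\<^sup>2" h]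
      by (simp add: algebra_simps power2_eq_square)
    also have "\<dots> \<le> exp (- h) * (1 + h + h\<^sup>2)"
    proof (rule mult_right_mono)
      show "1 - h \<le> exp (- h)" using exp_ge_add_one_self[of "- h"] by simp
      show "0 \<le> 1 + h + h\<^sup>2" using assms zero_le_power2[of h] by linarith
    qed
    finally show ?thesis by (simp add: exp_minus field_simps)
  qed
  then show ?thesis
    using exp_ge_add_one_self[of h] zero_le_power2[of h] unfolding abs_le_iff by linarith
qed

lemma C0_exp_has_derivative:
  "(C0_exp has_derivative (\<lambda>h. C0_mult (C0_exp f) h)) (at f)"
proof (rule has_derivativeI_sandwich[where e = 1])
  show "bounded_linear (C0_mult (C0_exp f))"
  proof (rule bounded_linear_intro)
    show "C0_mult (C0_exp f) (g + h) = C0_mult (C0_exp f) g + C0_mult (C0_exp f) h" for g h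
      by transfer (auto simp: algebra_simps)
    show "C0_mult (C0_exp f) (c *\<^sub>R g) = c *\<^sub>R C0_mult (C0_exp f) g" for c g
      by transfer (auto simp: algebra_simps)
    show "norm (C0_mult (C0_exp f) g) \<le> norm g * norm (C0_exp f)" for g
      using norm_C0_mult_le[of "C0_exp f" g] by (simp add: mult.commute)
  qed
  show "((\<lambda>g. norm (C0_exp f) * norm (g - f)) \<longlongrightarrow> 0) (at f)"
  proof -
    have "((\<lambda>g. norm (C0_exp f) * norm (g - f)) \<longlongrightarrow> norm (C0_exp f) * norm (f - f)) (at f)"
      by (intro tendsto_intros)
    then show ?thesis by simp
  qed
  fix g :: C0 assume g: "g \<noteq> f" "dist g f < 1"
  have "norm (C0_exp g - C0_exp f - C0_mult (C0_exp f) (g - f)) \<le>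
      norm (C0_exp f) * (norm (g - f))\<^sup>2"
  proof (rule norm_C0_le)
    fix x assume x: "x \<in> Ivl"
    define h where "h = C0_apply (g - f) x"
    have h: "\<bar>h\<bar> \<le> norm (g - f)" unfolding h_def by (rule C0_apply_le_norm)
    then have h1: "\<bar>h\<bar> \<le> 1" using g(2) by (simp add: dist_norm)
    have "exp (C0_apply g x) = exp (C0_apply f x) * exp h"
      by (simp add: h_def minus_C0.rep_eq flip: exp_add)
    then have "\<bar>C0_apply (C0_exp g - C0_exp f - C0_mult (C0_exp f) (g - f)) x\<bar> =
        \<bar>exp (C0_apply f x) * (exp h - 1 - h)\<bar>"
      using x by (simp del: atLeastAtMost_iff
            add: minus_C0.rep_eq C0_exp.rep_eq C0_mult.rep_eq h_def right_diff_distrib)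
    also have "\<dots> = \<bar>C0_apply (C0_exp f) x\<bar> * \<bar>exp h - 1 - h\<bar>"
      using x by (simp add: C0_exp.rep_eq abs_mult)
    also have "\<dots> \<le> norm (C0_exp f) * (norm (g - f))\<^sup>2"
    proof (intro mult_mono C0_apply_le_norm)
      show "\<bar>exp h - 1 - h\<bar> \<le> (norm (g - f))\<^sup>2"
        using exp_remainder_le[OF h1] h power_mono[OF h, of 2] by simp
    qed auto
    finally show "\<bar>C0_apply (C0_exp g - C0_exp f - C0_mult (C0_exp f) (g - f)) x\<bar>
      \<le> norm (C0_exp f) * (norm (g - f))\<^sup>2" .
  qed
  then show "norm (C0_exp g - C0_exp f - C0_mult (C0_exp f) (g - f)) / norm (g - f)
      \<le> norm (C0_exp f) * norm (g - f)"
    using g(1) by (simp add: field_simps power2_eq_square)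
qed simp

lemma X_val_bounded_linear: "bounded_linear X_val"
  by (rule bounded_linear_intro[where K = 1])
    (simp_all add: linear_add[OF X_val_linear] linear_scale[OF X_val_linear] norm_X_def)

lemma X_d2_bounded_linear: "bounded_linear X_d2"
  by (rule bounded_linear_intro[where K = 1])
    (simp_all add: linear_add[OF X_d2_linear] linear_scale[OF X_d2_linear] norm_X_def)

lemma bratu_F_has_derivative:
  "((\<lambda>v. bratu_F (v, l)) has_derivative
     (\<lambda>w. X_d2 w + l *\<^sub>R C0_mult (C0_exp (X_val u)) (X_val w))) (at u)"
  unfolding bratu_F_def prod.case
  by (intro has_derivative_add has_derivative_scaleR_right
      bounded_linear.has_derivative[OF X_d2_bounded_linear] has_derivative_ident
      has_derivative_compose[OF _ C0_exp_has_derivative]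
      bounded_linear.has_derivative[OF X_val_bounded_linear])

lemma bratu_DuF_eq:
  "bratu_DuF (u, l) w = X_d2 w + l *\<^sub>R C0_mult (C0_exp (X_val u)) (X_val w)"
  unfolding bratu_DuF_def prod.case
  using frechet_derivative_at[OF bratu_F_has_derivative[of l u]] by metis

lemma bratu_DuF_apply:
  "x \<in> Ivl \<Longrightarrow> C0_apply (bratu_DuF (u, l) w) x =
    ivl_deriv (ivl_deriv (X_apply w)) x + l * exp (X_apply u x) * X_apply w x"
  by (simp add: bratu_DuF_eq plus_C0.rep_eq scaleR_C0.rep_eq C0_exp.rep_eq C0_mult.rep_eq
      X_d2.rep_eq X_val.rep_eq)

lemma bratu_DlF_eq: "bratu_DlF (u, l) = C0_exp (X_val u)"
proof -
  have "((\<lambda>m. bratu_F (u, m)) has_vector_derivative C0_exp (X_val u)) (at l)"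
    unfolding bratu_F_def prod.case by (auto intro!: derivative_eq_intros)
  then show ?thesis by (simp add: bratu_DlF_def vector_derivative_at)
qed

section \<open>The primary path\<close>

definition bratu_fun :: "real \<Rightarrow> real \<Rightarrow> real" where
  "bratu_fun \<alpha> x = (if x \<in> Ivl then - 2 * ln (cosh (\<alpha> * x) / cosh \<alpha>) else 0)"

lemma bratu_fun_derivs:
  "bratu_fun \<alpha> differentiable_on Ivl" "ivl_deriv (bratu_fun \<alpha>) differentiable_on Ivl"
  "ivl_deriv (ivl_deriv (bratu_fun \<alpha>)) = (\<lambda>x. if x \<in> Ivl then - 2 * (\<alpha> / cosh (\<alpha> * x))\<^sup>2 else 0)"
proof -
  let ?g = "\<lambda>x. if x \<in> Ivl then - 2 * \<alpha> * (sinh (\<alpha> * x) / cosh (\<alpha> * x)) else 0"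
  let ?h = "\<lambda>x. if x \<in> Ivl then - 2 * (\<alpha> / cosh (\<alpha> * x))\<^sup>2 else 0"
  have 1: "(bratu_fun \<alpha> has_real_derivative ?g x) (at x within Ivl)" if x: "x \<in> Ivl" for x
  proof (rule has_field_derivative_transform_within[OF _ zero_less_one x])
    show "((\<lambda>x. - 2 * ln (cosh (\<alpha> * x) / cosh \<alpha>)) has_real_derivative ?g x) (at x within Ivl)"
      using x by (auto intro!: derivative_eq_intros simp: field_simps)
  qed (simp add: bratu_fun_def)
  have 2: "(?g has_real_derivative ?h x) (at x within Ivl)" if x: "x \<in> Ivl" for x
  proof (rule has_field_derivative_transform_within[OF _ zero_less_one x])
    have "cosh (\<alpha> * x) * cosh (\<alpha> * x) - sinh (\<alpha> * x) * sinh (\<alpha> * x) = 1"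
      using hyperbolic_pythagoras[of "\<alpha> * x"] by (simp add: power2_eq_square)
    then have "(\<alpha> * cosh (\<alpha> * x) * cosh (\<alpha> * x) - sinh (\<alpha> * x) * (\<alpha> * sinh (\<alpha> * x))) = \<alpha>"
      by (metis mult.assoc mult.left_commute mult.right_neutral right_diff_distrib)
    then have eq: "- 2 * \<alpha> * ((\<alpha> * cosh (\<alpha> * x) * cosh (\<alpha> * x) - sinh (\<alpha> * x) * (\<alpha> * sinh (\<alpha> * x))) /
        (cosh (\<alpha> * x) * cosh (\<alpha> * x))) = ?h x"
      using x by (simp add: power2_eq_square)
    have "((\<lambda>x. - 2 * \<alpha> * (sinh (\<alpha> * x) / cosh (\<alpha> * x))) has_real_derivative
        - 2 * \<alpha> * ((\<alpha> * cosh (\<alpha> * x) * cosh (\<alpha> * x) - sinh (\<alpha> * x) * (\<alpha> * sinh (\<alpha> * x))) /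
        (cosh (\<alpha> * x) * cosh (\<alpha> * x)))) (at x within Ivl)"
      by (intro DERIV_cmult DERIV_divide) (auto intro!: derivative_eq_intros)
    then show "((\<lambda>x. - 2 * \<alpha> * (sinh (\<alpha> * x) / cosh (\<alpha> * x))) has_real_derivative ?h x)
        (at x within Ivl)"
      unfolding eq .
  qed simp
  have g: "ivl_deriv (bratu_fun \<alpha>) = ?g" by (rule ivl_derivI(2)) (use 1 in auto)
  show "bratu_fun \<alpha> differentiable_on Ivl" by (rule ivl_derivI(1)[of _ ?g]) (use 1 in auto)
  show "ivl_deriv (bratu_fun \<alpha>) differentiable_on Ivl"
    unfolding g by (rule ivl_derivI(1)[of _ ?h]) (use 2 in auto)
  show "ivl_deriv (ivl_deriv (bratu_fun \<alpha>)) = ?h"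
    unfolding g by (rule ivl_derivI(2)) (use 2 in auto)
qed

lift_definition bratu_u0 :: "real \<Rightarrow> X" is bratu_fun
proof -
  fix \<alpha>
  have "continuous_on Ivl (\<lambda>x. - 2 * (\<alpha> / cosh (\<alpha> * x))\<^sup>2)"
    by (intro continuous_intros) auto
  then show "C2_on_Ivl (bratu_fun \<alpha>) \<and> bratu_fun \<alpha> (-1) = 0 \<and> bratu_fun \<alpha> 1 = 0 \<and>
      (\<forall>x. x \<notin> Ivl \<longrightarrow> bratu_fun \<alpha> x = 0)"
    by (simp add: C2_on_Ivl_def bratu_fun_derivs bratu_fun_def cong: continuous_on_cong_simp)
qed

definition bratu_l0 :: "real \<Rightarrow> real" where
  "bratu_l0 \<alpha> = 2 * (\<alpha> / cosh \<alpha>)\<^sup>2"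

definition bratu_path :: "(X \<times> real) set" where
  "bratu_path = {(bratu_u0 \<alpha>, bratu_l0 \<alpha>) | \<alpha>. \<alpha> > 0}"

lemma bratu_path_nontrivial_solutions:
  assumes "p \<in> bratu_path"
  shows "bratu_F p = 0" "fst p \<noteq> 0"
proof -
  obtain \<alpha> where p: "p = (bratu_u0 \<alpha>, bratu_l0 \<alpha>)" and pos: "\<alpha> > 0"
    using assms by (auto simp: bratu_path_def)
  show "bratu_F p = 0"
  proof (rule C0_eqI)
    fix x assume x: "x \<in> Ivl"
    let ?y = "cosh (\<alpha> * x) / cosh \<alpha>"
    have "exp (- 2 * ln ?y) = inverse (exp (ln ?y) * exp (ln ?y))"
      unfolding exp_minus[symmetric] exp_add[symmetric] by (rule arg_cong[where f = exp]) simp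
    also have "exp (ln ?y) = ?y" by simp
    finally have "exp (bratu_fun \<alpha> x) = inverse (?y * ?y)"
      using x by (simp add: bratu_fun_def)
    then show "C0_apply (bratu_F p) x = C0_apply 0 x"
      unfolding p bratu_F_apply[OF x] bratu_u0.rep_eq bratu_fun_derivs(3)
      using x by (simp add: zero_C0.rep_eq bratu_l0_def power2_eq_square field_simps)
  qed
  have "cosh \<alpha> > 1" using pos cosh_real_strict_mono[of 0 \<alpha>] by simp
  then have "X_apply (bratu_u0 \<alpha>) 0 > 0"
    by (simp add: bratu_u0.rep_eq bratu_fun_def ln_div)
  then show "fst p \<noteq> 0" by (auto simp: p zero_X.rep_eq)
qed

section \<open>Critical, limit and bifurcation points\<close>

definition critical_point :: "X \<times> real \<Rightarrow> bool" where
  "critical_point p \<longleftrightarrow> (\<exists>w. w \<noteq> 0 \<and> bratu_DuF p w = 0)"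

definition limit_point :: "X \<times> real \<Rightarrow> bool" where
  "limit_point p \<longleftrightarrow> critical_point p \<and> dim {w. bratu_DuF p w = 0} = 1 \<and>
     bratu_DlF p \<notin> range (bratu_DuF p)"

definition bifurcation_point :: "X \<times> real \<Rightarrow> bool" where
  "bifurcation_point p \<longleftrightarrow> p \<in> bratu_path \<and>
     (\<forall>N. open N \<and> p \<in> N \<longrightarrow> (\<exists>q\<in>N. bratu_F q = 0 \<and> q \<notin> bratu_path))"

end

theory Submission
  imports Defs
begin

text \<open>
  Both the linearised and the nonlinear equation are solved explicitly, so that no abstract
  bifurcation theory is needed.

  Along the path, \<open>\<lambda>\<^sub>0 exp u\<^sub>0 = 2\<alpha>\<^sup>2 (1 - tanh\<^sup>2 (\<alpha>x))\<close>. Differentiating the solution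
  family of the differential equation with respect to translation and to scaling gives two
  solutions of the linearised equation, the odd function \<open>tanh (\<alpha>x)\<close> and the even function
  \<open>\<phi> x = 1 - \<alpha>x tanh (\<alpha>x)\<close>. Their Wronskian is constant and nonzero, so they span all
  solutions (lemma \<open>linearised_solution\<close>). The odd one does not vanish at the end points;
  hence the linearised boundary value problem has a nonzero solution exactly when
  \<open>\<phi> 1 = 1 - \<alpha> tanh \<alpha> = 0\<close>, and the kernel is then spanned by \<open>\<phi>\<close>. As \<open>\<alpha> tanh \<alpha>\<close>
  increases strictly from \<open>0\<close> to infinity, this happens for exactly one \<open>\<alpha> > 0\<close>.

  At that point, \<open>D\<^sub>uF v = exp u\<^sub>0\<close> would make
  \<open>\<lambda>\<^sub>0 (v' \<phi> - v \<phi>') + \<phi>'\<close> constant, so that \<open>\<phi>' 1 = \<phi>' (-1)\<close>. But \<open>\<phi>'\<close> is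
  odd and \<open>\<phi>' 1 < 0\<close> (lemma \<open>exp_notin_range\<close>).

  Finally, the path contains all solutions with \<open>\<lambda> > 0\<close> (lemma
  \<open>positive_solution_in_path\<close>): if \<open>u\<close> is a solution, the energy \<open>u'\<^sup>2 / 2 + \<lambda> exp u\<close> is a
  constant \<open>2k\<^sup>2\<close>, which makes \<open>exp (- u / 2)\<close> a solution of the linear equation
  \<open>y'' = k\<^sup>2 y\<close>. Since \<open>\<lambda> > 0\<close> is an open condition that holds on the path, no other solution
  comes near a point of the path.
\<close>

section \<open>Calculus on the interval\<close>

lemma constant_on_Ivl:
  fixes f :: "real \<Rightarrow> real"
  assumes "\<And>x. x \<in> Ivl \<Longrightarrow> (f has_real_derivative 0) (at x within Ivl)"
    and "x \<in> Ivl" "y \<in> Ivl"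
  shows "f x = f y"
  using has_field_derivative_zero_constant[of Ivl f] assms by (metis convex_closed_interval)

lemma X_derivs:
  assumes "x \<in> Ivl"
  shows "(X_apply w has_real_derivative ivl_deriv (X_apply w) x) (at x within Ivl)"
    and "(ivl_deriv (X_apply w) has_real_derivative ivl_deriv (ivl_deriv (X_apply w)) x)
      (at x within Ivl)"
  using X_apply[of w] assms by (auto simp: C2_on_Ivl_def intro!: ivl_deriv_works)

lemma X_boundary: "X_apply w 1 = 0" "X_apply w (-1) = 0"
  using X_apply[of w] by auto

lemma X_eqI:
  assumes "\<And>x. x \<in> Ivl \<Longrightarrow> X_apply v x = X_apply w x"
  shows "v = w"
proof -
  have "X_apply v x = X_apply w x" for x
    using assms X_apply[of v] X_apply[of w] by (cases "x \<in> Ivl") auto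
  then show ?thesis by (metis X_apply_inject ext)
qed

lemma X_exists:
  assumes f: "\<And>x. x \<in> Ivl \<Longrightarrow> (f has_real_derivative f' x) (at x within Ivl)"
    and f': "\<And>x. x \<in> Ivl \<Longrightarrow> (f' has_real_derivative f'' x) (at x within Ivl)"
    and cont: "continuous_on Ivl f''" and bd: "f (-1) = 0" "f 1 = 0"
  obtains w where "\<And>x. x \<in> Ivl \<Longrightarrow> X_apply w x = f x"
    and "\<And>x. x \<in> Ivl \<Longrightarrow> ivl_deriv (ivl_deriv (X_apply w)) x = f'' x"
proof -
  let ?ext = "\<lambda>g x. if x \<in> Ivl then g x else 0 :: real"
  have ext: "(?ext g has_real_derivative ?ext g' x) (at x within Ivl)"
    if "(g has_real_derivative g' x) (at x within Ivl)" "x \<in> Ivl" for g g' x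
    by (rule has_field_derivative_transform_within[where f = g and d = 1]) (use that in auto)
  have 1: "?ext f differentiable_on Ivl" "ivl_deriv (?ext f) = ?ext f'"
    by (rule ivl_derivI[where g = "?ext f'"]; use ext f in auto)+
  have 2: "?ext f' differentiable_on Ivl" "ivl_deriv (?ext f') = ?ext f''"
    by (rule ivl_derivI[where g = "?ext f''"]; use ext f' in auto)+
  have "continuous_on Ivl (?ext f'')"
    using cont by (simp cong: continuous_on_cong_simp)
  then have "?ext f \<in> {u. C2_on_Ivl u \<and> u (-1) = 0 \<and> u 1 = 0 \<and> (\<forall>x. x \<notin> Ivl \<longrightarrow> u x = 0)}"
    using 1 2 bd unfolding C2_on_Ivl_def by simp
  then have w: "X_apply (Abs_X (?ext f)) = ?ext f"
    by (rule Abs_X_inverse)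
  show thesis
    by (rule that[of "Abs_X (?ext f)"]) (simp_all only: w 1 2 if_True)
qed

section \<open>The linearised equation\<close>

text \<open>The infinitesimal scaling of the solution: \<open>2 \<phi>\<close> is the derivative at \<open>s = 1\<close> of
  \<open>u\<^sub>0 (s x) + 2 ln s\<close>, which solves the nonlinear differential equation for every \<open>s > 0\<close>.\<close>

definition even_mode :: "real \<Rightarrow> real \<Rightarrow> real" where
  "even_mode \<alpha> x = 1 - \<alpha> * x * tanh (\<alpha> * x)"

definition even_mode' :: "real \<Rightarrow> real \<Rightarrow> real" where
  "even_mode' \<alpha> x = - \<alpha> * tanh (\<alpha> * x) - \<alpha>\<^sup>2 * x * (1 - (tanh (\<alpha> * x))\<^sup>2)"

lemma tanh_derivs:
  fixes \<alpha> :: real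
  shows "((\<lambda>x. tanh (\<alpha> * x)) has_real_derivative \<alpha> * (1 - (tanh (\<alpha> * x))\<^sup>2)) (at x within S)"
    and "((\<lambda>x. \<alpha> * (1 - (tanh (\<alpha> * x))\<^sup>2)) has_real_derivative
      - 2 * \<alpha>\<^sup>2 * (1 - (tanh (\<alpha> * x))\<^sup>2) * tanh (\<alpha> * x)) (at x within S)"
proof -
  show 1: "((\<lambda>x. tanh (\<alpha> * x)) has_real_derivative \<alpha> * (1 - (tanh (\<alpha> * x))\<^sup>2)) (at x within S)"
    by (auto intro!: derivative_eq_intros simp: less_imp_neq[OF cosh_real_pos, symmetric])
  show "((\<lambda>x. \<alpha> * (1 - (tanh (\<alpha> * x))\<^sup>2)) has_real_derivative
      - 2 * \<alpha>\<^sup>2 * (1 - (tanh (\<alpha> * x))\<^sup>2) * tanh (\<alpha> * x)) (at x within S)"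
    by (rule derivative_eq_intros 1 refl)+ (simp add: power2_eq_square algebra_simps)
qed

lemma even_mode_derivs:
  shows "(even_mode \<alpha> has_real_derivative even_mode' \<alpha> x) (at x within S)"
    and "(even_mode' \<alpha> has_real_derivative
      - 2 * \<alpha>\<^sup>2 * (1 - (tanh (\<alpha> * x))\<^sup>2) * even_mode \<alpha> x) (at x within S)"
proof -
  show "(even_mode \<alpha> has_real_derivative even_mode' \<alpha> x) (at x within S)"
    unfolding even_mode_def[abs_def] even_mode'_def
    by (rule derivative_eq_intros tanh_derivs refl)+ (simp add: power2_eq_square algebra_simps)
  show "(even_mode' \<alpha> has_real_derivative
      - 2 * \<alpha>\<^sup>2 * (1 - (tanh (\<alpha> * x))\<^sup>2) * even_mode \<alpha> x) (at x within S)"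
    unfolding even_mode_def even_mode'_def[abs_def]
    by (rule derivative_eq_intros tanh_derivs refl)+ (simp add: power2_eq_square algebra_simps)
qed

lemma even_mode_even: "even_mode \<alpha> (- x) = even_mode \<alpha> x"
  by (simp add: even_mode_def)

lemma even_mode'_odd: "even_mode' \<alpha> (- x) = - even_mode' \<alpha> x"
  by (simp add: even_mode'_def)

text \<open>The Wronskian of two solutions of \<open>y'' + q y = 0\<close> is constant. The solution \<open>w\<close> is
  recovered from its Wronskians with the two explicit solutions.\<close>

lemma linearised_solution:
  fixes w w' :: "real \<Rightarrow> real"
  assumes w: "\<And>x. x \<in> Ivl \<Longrightarrow> (w has_real_derivative w' x) (at x within Ivl)"
    and w': "\<And>x. x \<in> Ivl \<Longrightarrow>
      (w' has_real_derivative - 2 * \<alpha>\<^sup>2 * (1 - (tanh (\<alpha> * x))\<^sup>2) * w x) (at x within Ivl)"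
    and "\<alpha> \<noteq> 0" and x: "x \<in> Ivl"
  shows "w x = w 0 * even_mode \<alpha> x + w' 0 / \<alpha> * tanh (\<alpha> * x)"
proof -
  define W1 where "W1 x = w' x * tanh (\<alpha> * x) - w x * (\<alpha> * (1 - (tanh (\<alpha> * x))\<^sup>2))" for x
  define W2 where "W2 x = w' x * even_mode \<alpha> x - w x * even_mode' \<alpha> x" for x
  have "W1 x = W1 0"
  proof (rule constant_on_Ivl[where f = W1])
    show "(W1 has_real_derivative 0) (at y within Ivl)" if "y \<in> Ivl" for y
      unfolding W1_def[abs_def]
      by (rule derivative_eq_intros tanh_derivs w[OF that] w'[OF that] refl)+
        (simp add: algebra_simps)
  qed (use x in auto)
  then have 1: "w' x * tanh (\<alpha> * x) - w x * (\<alpha> * (1 - (tanh (\<alpha> * x))\<^sup>2)) = - w 0 * \<alpha>"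
    by (simp add: W1_def)
  have "W2 x = W2 0"
  proof (rule constant_on_Ivl[where f = W2])
    show "(W2 has_real_derivative 0) (at y within Ivl)" if "y \<in> Ivl" for y
      unfolding W2_def[abs_def]
      by (rule derivative_eq_intros even_mode_derivs w[OF that] w'[OF that] refl)+
        (simp add: algebra_simps)
  qed (use x in auto)
  then have 2: "w' x * even_mode \<alpha> x - w x * even_mode' \<alpha> x = w' 0"
    by (simp add: W2_def even_mode_def even_mode'_def)
  \<comment> \<open>the Wronskian of the two explicit solutions\<close>
  have "\<alpha> * (1 - (tanh (\<alpha> * x))\<^sup>2) * even_mode \<alpha> x - tanh (\<alpha> * x) * even_mode' \<alpha> x = \<alpha>"
    by (simp add: even_mode_def even_mode'_def power2_eq_square algebra_simps)
  then have "w x * \<alpha> = w x * (\<alpha> * (1 - (tanh (\<alpha> * x))\<^sup>2) * even_mode \<alpha> x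
      - tanh (\<alpha> * x) * even_mode' \<alpha> x)"
    by simp
  also have "\<dots> = (w' x * even_mode \<alpha> x - w x * even_mode' \<alpha> x) * tanh (\<alpha> * x)
      - (w' x * tanh (\<alpha> * x) - w x * (\<alpha> * (1 - (tanh (\<alpha> * x))\<^sup>2))) * even_mode \<alpha> x"
    by (simp add: algebra_simps)
  also have "\<dots> = w' 0 * tanh (\<alpha> * x) + w 0 * \<alpha> * even_mode \<alpha> x"
    unfolding 1 2 by simp
  finally show ?thesis using \<open>\<alpha> \<noteq> 0\<close> by (simp add: field_simps)
qed

lemma bratu_potential:
  assumes "\<alpha> > 0" "x \<in> Ivl"
  shows "bratu_l0 \<alpha> * exp (X_apply (bratu_u0 \<alpha>) x) = 2 * \<alpha>\<^sup>2 * (1 - (tanh (\<alpha> * x))\<^sup>2)"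
proof -
  have "bratu_F (bratu_u0 \<alpha>, bratu_l0 \<alpha>) = 0"
    using assms by (intro bratu_path_nontrivial_solutions) (auto simp: bratu_path_def)
  then have "bratu_l0 \<alpha> * exp (X_apply (bratu_u0 \<alpha>) x) = 2 * (\<alpha> / cosh (\<alpha> * x))\<^sup>2"
    using bratu_F_apply[OF assms(2), of "bratu_u0 \<alpha>" "bratu_l0 \<alpha>"] assms(2)
    by (simp add: bratu_u0.rep_eq bratu_fun_derivs(3) zero_C0.rep_eq)
  moreover have "(cosh (\<alpha> * x))\<^sup>2 * (1 - (tanh (\<alpha> * x))\<^sup>2) = 1"
    using hyperbolic_pythagoras[of "\<alpha> * x"]
    by (simp add: tanh_def power_divide right_diff_distrib)
  then have "1 - (tanh (\<alpha> * x))\<^sup>2 = 1 / (cosh (\<alpha> * x))\<^sup>2"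
    by (simp add: field_simps)
  ultimately show ?thesis by (simp add: power_divide)
qed

lemma DuF_path_apply:
  assumes "\<alpha> > 0" "x \<in> Ivl"
  shows "C0_apply (bratu_DuF (bratu_u0 \<alpha>, bratu_l0 \<alpha>) w) x =
    ivl_deriv (ivl_deriv (X_apply w)) x + 2 * \<alpha>\<^sup>2 * (1 - (tanh (\<alpha> * x))\<^sup>2) * X_apply w x"
  using bratu_potential[OF assms] bratu_DuF_apply[OF assms(2)] by metis

lemma DuF_path_eq_0_iff:
  assumes "\<alpha> > 0"
  shows "bratu_DuF (bratu_u0 \<alpha>, bratu_l0 \<alpha>) w = 0 \<longleftrightarrow>
    (\<forall>x\<in>Ivl. ivl_deriv (ivl_deriv (X_apply w)) x =
      - 2 * \<alpha>\<^sup>2 * (1 - (tanh (\<alpha> * x))\<^sup>2) * X_apply w x)" (is "?L = 0 \<longleftrightarrow> ?R")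
proof -
  have "?L = 0 \<longleftrightarrow> (\<forall>x\<in>Ivl. C0_apply ?L x = 0)"
    by (metis C0_eqI zero_C0.rep_eq)
  also have "\<dots> \<longleftrightarrow> ?R"
    by (intro ball_cong refl) (simp only: DuF_path_apply[OF assms], smt (verit) mult_minus_left)
  finally show ?thesis .
qed

lemma kernel_apply:
  assumes "\<alpha> > 0" "bratu_DuF (bratu_u0 \<alpha>, bratu_l0 \<alpha>) w = 0"
  shows "\<And>x. x \<in> Ivl \<Longrightarrow> X_apply w x = X_apply w 0 * even_mode \<alpha> x"
    and "X_apply w 0 * even_mode \<alpha> 1 = 0"
proof -
  let ?b = "ivl_deriv (X_apply w) 0 / \<alpha>"
  have sol: "X_apply w x = X_apply w 0 * even_mode \<alpha> x + ?b * tanh (\<alpha> * x)"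
    if "x \<in> Ivl" for x
  proof (rule linearised_solution[OF X_derivs(1) _ _ that])
    show "(ivl_deriv (X_apply w) has_real_derivative
        - 2 * \<alpha>\<^sup>2 * (1 - (tanh (\<alpha> * y))\<^sup>2) * X_apply w y) (at y within Ivl)" if "y \<in> Ivl" for y
      using X_derivs(2)[OF that, of w] assms that by (metis DuF_path_eq_0_iff)
  qed (use assms in auto)
  have "0 = X_apply w 0 * even_mode \<alpha> 1 + ?b * tanh \<alpha>"
    "0 = X_apply w 0 * even_mode \<alpha> 1 - ?b * tanh \<alpha>"
    using sol[of 1] sol[of "-1"] by (simp_all add: X_boundary even_mode_even)
  then have "?b * tanh \<alpha> = 0" by linarith
  then have b: "?b = 0" using assms(1) by simp
  show "X_apply w x = X_apply w 0 * even_mode \<alpha> x" if "x \<in> Ivl" for x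
    using sol[OF that] b by simp
  from this[of 1] show "X_apply w 0 * even_mode \<alpha> 1 = 0"
    by (simp add: X_boundary)
qed

lemma kernel_element:
  assumes "\<alpha> > 0" "even_mode \<alpha> 1 = 0"
  obtains v where "\<And>x. x \<in> Ivl \<Longrightarrow> X_apply v x = even_mode \<alpha> x"
    and "bratu_DuF (bratu_u0 \<alpha>, bratu_l0 \<alpha>) v = 0"
proof -
  have "continuous_on Ivl (\<lambda>x. - 2 * \<alpha>\<^sup>2 * (1 - (tanh (\<alpha> * x))\<^sup>2) * even_mode \<alpha> x)"
    unfolding even_mode_def by (intro continuous_intros) auto
  then obtain v where "\<And>x. x \<in> Ivl \<Longrightarrow> X_apply v x = even_mode \<alpha> x"
    and "\<And>x. x \<in> Ivl \<Longrightarrow> ivl_deriv (ivl_deriv (X_apply v)) x =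
      - 2 * \<alpha>\<^sup>2 * (1 - (tanh (\<alpha> * x))\<^sup>2) * even_mode \<alpha> x"
    using X_exists[OF even_mode_derivs[of \<alpha>]] assms(2) even_mode_even[of \<alpha> 1] by metis
  then show thesis using that[of v] DuF_path_eq_0_iff[OF assms(1), of v] by simp
qed

section \<open>The critical point\<close>

lemma critical_point_iff:
  assumes "\<alpha> > 0"
  shows "critical_point (bratu_u0 \<alpha>, bratu_l0 \<alpha>) \<longleftrightarrow> even_mode \<alpha> 1 = 0"
proof
  assume "critical_point (bratu_u0 \<alpha>, bratu_l0 \<alpha>)"
  then obtain w where w: "w \<noteq> 0" "bratu_DuF (bratu_u0 \<alpha>, bratu_l0 \<alpha>) w = 0"
    by (auto simp: critical_point_def)
  have "X_apply w 0 \<noteq> 0"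
  proof
    assume "X_apply w 0 = 0"
    then have "X_apply w x = 0" if "x \<in> Ivl" for x
      using kernel_apply(1)[OF assms w(2) that] by (metis mult_zero_left)
    then have "w = 0" by (intro X_eqI) (simp only: zero_X.rep_eq)
    then show False using w(1) by simp
  qed
  then show "even_mode \<alpha> 1 = 0" using kernel_apply(2)[OF assms w(2)] by simp
next
  assume "even_mode \<alpha> 1 = 0"
  then obtain v where v: "\<And>x. x \<in> Ivl \<Longrightarrow> X_apply v x = even_mode \<alpha> x"
    "bratu_DuF (bratu_u0 \<alpha>, bratu_l0 \<alpha>) v = 0"
    using kernel_element[OF assms] by blast
  have "X_apply v 0 = 1" using v(1)[of 0] by (simp add: even_mode_def)
  then have "v \<noteq> 0" by (auto simp: zero_X.rep_eq)
  then show "critical_point (bratu_u0 \<alpha>, bratu_l0 \<alpha>)"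
    using v(2) by (auto simp: critical_point_def)
qed

lemma even_mode_zero_unique:
  shows "\<exists>!\<alpha>. \<alpha> > 0 \<and> even_mode \<alpha> 1 = 0"
proof (rule ex_ex1I)
  have "isCont (\<lambda>\<alpha>::real. \<alpha> * tanh \<alpha>) x" for x
    by (intro continuous_intros) auto
  \<comment> \<open>the crude bound \<open>exp (-4) \<le> 1/5\<close> already gives \<open>tanh 2 \<ge> 2/3\<close>\<close>
  moreover have "1 \<le> 2 * tanh (2::real)"
  proof -
    have "exp (- 2 * 2 :: real) \<le> 1 / (1 + 2 * 2)"
      using exp_ge_add_one_self[of "4::real"] by (simp add: exp_minus field_simps)
    moreover have "0 < 1 + exp (- 2 * 2 :: real)" by (intro add_pos_pos) auto
    ultimately show ?thesis unfolding tanh_real_altdef by (simp add: le_divide_eq)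
  qed
  ultimately obtain \<alpha> :: real where "0 \<le> \<alpha>" "\<alpha> * tanh \<alpha> = 1"
    using IVT[of "\<lambda>\<alpha>::real. \<alpha> * tanh \<alpha>" 0 1 2] by auto
  then have "\<alpha> > 0 \<and> even_mode \<alpha> 1 = 0"
    by (cases "\<alpha> = 0") (auto simp: even_mode_def)
  then show "\<exists>\<alpha>. \<alpha> > 0 \<and> even_mode \<alpha> 1 = 0" ..
next
  have less: "\<alpha> * tanh \<alpha> < \<beta> * tanh \<beta>" if "0 < \<alpha>" "\<alpha> < \<beta>" for \<alpha> \<beta> :: real
    using that by (intro mult_strict_mono) auto
  fix \<alpha> \<beta> :: real
  assume "\<alpha> > 0 \<and> even_mode \<alpha> 1 = 0" "\<beta> > 0 \<and> even_mode \<beta> 1 = 0"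
  then show "\<alpha> = \<beta>"
    using less[of \<alpha> \<beta>] less[of \<beta> \<alpha>] by (cases \<alpha> \<beta> rule: linorder_cases) (auto simp: even_mode_def)
qed

lemma dim_kernel:
  assumes "\<alpha> > 0" "even_mode \<alpha> 1 = 0"
  shows "dim {w. bratu_DuF (bratu_u0 \<alpha>, bratu_l0 \<alpha>) w = 0} = 1"
proof -
  obtain v where v: "\<And>x. x \<in> Ivl \<Longrightarrow> X_apply v x = even_mode \<alpha> x"
    "bratu_DuF (bratu_u0 \<alpha>, bratu_l0 \<alpha>) v = 0"
    using kernel_element[OF assms] by blast
  have "X_apply v 0 = 1" using v(1)[of 0] by (simp add: even_mode_def)
  then have "v \<noteq> 0" by (auto simp: zero_X.rep_eq)
  show ?thesis
  proof (rule dim_unique[of "{v}"])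
    show "{w. bratu_DuF (bratu_u0 \<alpha>, bratu_l0 \<alpha>) w = 0} \<subseteq> span {v}"
    proof
      fix w assume "w \<in> {w. bratu_DuF (bratu_u0 \<alpha>, bratu_l0 \<alpha>) w = 0}"
      then have "X_apply w x = X_apply w 0 * even_mode \<alpha> x" if "x \<in> Ivl" for x
        using kernel_apply(1)[OF assms(1)] that by blast
      then have "w = X_apply w 0 *\<^sub>R v"
        by (intro X_eqI) (simp only: scaleR_X.rep_eq v(1))
      then show "w \<in> span {v}" by (metis span_base span_scale singletonI)
    qed
  qed (use v(2) \<open>v \<noteq> 0\<close> in auto)
qed

text \<open>Solvability against the kernel: testing \<open>D\<^sub>uF v = exp u\<^sub>0\<close> with the even mode, the right-hand
  side has the primitive \<open>- \<phi>' / \<lambda>\<^sub>0\<close>, because \<open>\<phi>\<close> itself solves the linearised equation,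
  and the left-hand side has the primitive \<open>v' \<phi> - v \<phi>'\<close>, which vanishes at both end points.
  The values of \<open>\<phi>'\<close> at the end points, however, differ.\<close>

lemma exp_notin_range:
  assumes "\<alpha> > 0" "even_mode \<alpha> 1 = 0"
  shows "bratu_DlF (bratu_u0 \<alpha>, bratu_l0 \<alpha>) \<notin> range (bratu_DuF (bratu_u0 \<alpha>, bratu_l0 \<alpha>))"
proof
  assume "bratu_DlF (bratu_u0 \<alpha>, bratu_l0 \<alpha>) \<in> range (bratu_DuF (bratu_u0 \<alpha>, bratu_l0 \<alpha>))"
  then obtain v where v: "bratu_DuF (bratu_u0 \<alpha>, bratu_l0 \<alpha>) v = C0_exp (X_val (bratu_u0 \<alpha>))"
    by (auto simp: bratu_DlF_eq)
  define g where "g x = bratu_l0 \<alpha> * (ivl_deriv (X_apply v) x * even_mode \<alpha> x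
    - X_apply v x * even_mode' \<alpha> x) + even_mode' \<alpha> x" for x
  have "g 1 = g (-1)"
  proof (rule constant_on_Ivl[where f = g])
    fix x :: real assume x: "x \<in> Ivl"
    define q where "q = 2 * \<alpha>\<^sup>2 * (1 - (tanh (\<alpha> * x))\<^sup>2)"
    let ?v'' = "ivl_deriv (ivl_deriv (X_apply v)) x"
    let ?e = "exp (X_apply (bratu_u0 \<alpha>) x)"
    have "?v'' + q * X_apply v x = ?e"
      using arg_cong[OF v, of "\<lambda>f. C0_apply f x"] x
      unfolding DuF_path_apply[OF assms(1) x] q_def by (simp add: C0_exp.rep_eq X_val.rep_eq)
    then have v'': "?v'' = ?e - q * X_apply v x" by simp
    have e: "bratu_l0 \<alpha> * ?e = q"
      unfolding q_def by (rule bratu_potential[OF assms(1) x])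
    have mode: "(even_mode' \<alpha> has_real_derivative - q * even_mode \<alpha> x) (at x within Ivl)"
      using even_mode_derivs(2)[of \<alpha> x Ivl] by (simp add: q_def)
    have "bratu_l0 \<alpha> * (?v'' * even_mode \<alpha> x + q * even_mode \<alpha> x * X_apply v x)
        = q * even_mode \<alpha> x"
      unfolding v'' e[symmetric] by (simp add: algebra_simps)
    then show "(g has_real_derivative 0) (at x within Ivl)"
      unfolding g_def[abs_def]
      by - ((rule derivative_eq_intros even_mode_derivs(1) mode X_derivs[OF x] refl)+,
        simp add: algebra_simps)
  qed auto
  then have "even_mode' \<alpha> 1 = even_mode' \<alpha> (-1)"
    using assms(2) even_mode_even[of \<alpha> 1] by (simp add: g_def X_boundary)
  then have "even_mode' \<alpha> 1 = 0" using even_mode'_odd[of \<alpha> 1] by simp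
  moreover have "\<alpha> * tanh \<alpha> > 0" "\<alpha>\<^sup>2 * (1 - (tanh \<alpha>)\<^sup>2) > 0"
    using assms(1) tanh_real_bounds[of \<alpha>] by (auto simp: abs_square_less_1 abs_less_iff)
  then have "even_mode' \<alpha> 1 < 0" by (simp add: even_mode'_def)
  ultimately show False by simp
qed

lemma critical_imp_limit_point:
  assumes "p \<in> bratu_path" "critical_point p"
  shows "limit_point p"
proof -
  obtain \<alpha> where p: "p = (bratu_u0 \<alpha>, bratu_l0 \<alpha>)" and "\<alpha> > 0"
    using assms(1) by (auto simp: bratu_path_def)
  then have "even_mode \<alpha> 1 = 0" using assms(2) critical_point_iff by blast
  then show ?thesis
    using assms(2) dim_kernel exp_notin_range \<open>\<alpha> > 0\<close> by (simp add: limit_point_def p)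
qed

section \<open>All solutions with positive parameter\<close>

lemma linear_hyperbolic_solution:
  fixes y y' :: "real \<Rightarrow> real"
  assumes y: "\<And>x. x \<in> Ivl \<Longrightarrow> (y has_real_derivative y' x) (at x within Ivl)"
    and y': "\<And>x. x \<in> Ivl \<Longrightarrow> (y' has_real_derivative k\<^sup>2 * y x) (at x within Ivl)"
    and "k \<noteq> 0" and x: "x \<in> Ivl"
  shows "y x = y 0 * cosh (k * x) + y' 0 / k * sinh (k * x)"
proof -
  define W1 where "W1 x = y x * k * cosh (k * x) - y' x * sinh (k * x)" for x
  define W2 where "W2 x = y' x * cosh (k * x) - y x * k * sinh (k * x)" for x
  have "W1 x = W1 0"
  proof (rule constant_on_Ivl[where f = W1])
    show "(W1 has_real_derivative 0) (at z within Ivl)" if "z \<in> Ivl" for z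
      unfolding W1_def[abs_def]
      by (rule derivative_eq_intros y[OF that] y'[OF that] refl)+
        (simp add: power2_eq_square algebra_simps)
  qed (use x in auto)
  moreover have "W2 x = W2 0"
  proof (rule constant_on_Ivl[where f = W2])
    show "(W2 has_real_derivative 0) (at z within Ivl)" if "z \<in> Ivl" for z
      unfolding W2_def[abs_def]
      by (rule derivative_eq_intros y[OF that] y'[OF that] refl)+
        (simp add: power2_eq_square algebra_simps)
  qed (use x in auto)
  moreover have "W1 x * cosh (k * x) + W2 x * sinh (k * x) =
      y x * k * ((cosh (k * x))\<^sup>2 - (sinh (k * x))\<^sup>2)"
    by (simp add: W1_def W2_def power2_eq_square algebra_simps)
  then have "W1 x * cosh (k * x) + W2 x * sinh (k * x) = y x * k"
    by (simp add: hyperbolic_pythagoras)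
  ultimately have "y 0 * k * cosh (k * x) + y' 0 * sinh (k * x) = y x * k"
    by (simp add: W1_def W2_def)
  then show ?thesis using \<open>k \<noteq> 0\<close> by (simp add: field_simps)
qed

text \<open>With \<open>y = exp (- u / 2)\<close> one gets \<open>y'' = (u'\<^sup>2 / 4 + l exp u / 2) y\<close>, whose coefficient is half
  the conserved energy. The boundary values \<open>y = 1\<close> at both ends exclude the odd part
  \<open>sinh (k x)\<close>, leaving \<open>y = cosh (k x) / cosh k\<close>; the energy at \<open>x = 0\<close>, where \<open>u' = 0\<close>,
  then determines \<open>l\<close>. Positivity of \<open>l\<close> is what makes the coefficient a square \<open>k\<^sup>2 > 0\<close>.\<close>

lemma positive_solution_in_path:
  assumes "bratu_F (u, l) = 0" "l > 0"
  shows "(u, l) \<in> bratu_path"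
proof -
  define f f' where "f = X_apply u" and "f' = ivl_deriv (X_apply u)"
  have f: "(f has_real_derivative f' x) (at x within Ivl)" if "x \<in> Ivl" for x
    unfolding f_def f'_def by (rule X_derivs(1)[OF that])
  have f': "(f' has_real_derivative - l * exp (f x)) (at x within Ivl)" if "x \<in> Ivl" for x
  proof -
    have "ivl_deriv (ivl_deriv (X_apply u)) x = - l * exp (f x)"
      using bratu_F_apply[OF that, of u l] assms(1) by (simp add: f_def zero_C0.rep_eq)
    then show ?thesis using X_derivs(2)[OF that, of u] by (simp add: f'_def)
  qed
  define E where "E x = (f' x)\<^sup>2 / 4 + l / 2 * exp (f x)" for x
  define k where "k = sqrt (E 0)"
  have "E 0 > 0"
    unfolding E_def using assms(2) by (intro add_nonneg_pos) auto
  then have k: "k > 0" "k\<^sup>2 = E 0" by (auto simp: k_def)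
  have E: "E x = k\<^sup>2" if "x \<in> Ivl" for x
    unfolding k
  proof (rule constant_on_Ivl[where f = E])
    show "(E has_real_derivative 0) (at z within Ivl)" if "z \<in> Ivl" for z
      unfolding E_def[abs_def]
      by (auto intro!: derivative_eq_intros f[OF that] f'[OF that])
  qed (use that in auto)
  define y where "y x = exp (- f x / 2)" for x
  define y' where "y' x = - f' x / 2 * y x" for x
  have y: "(y has_real_derivative y' x) (at x within Ivl)" if "x \<in> Ivl" for x
    unfolding y_def[abs_def] y'_def
    by (auto intro!: derivative_eq_intros f[OF that])
  have y': "(y' has_real_derivative k\<^sup>2 * y x) (at x within Ivl)" if "x \<in> Ivl" for x
    unfolding y'_def[abs_def] E[OF that, symmetric] E_def
    by (auto intro!: derivative_eq_intros y[OF that, unfolded y'_def] f'[OF that]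
        simp: power2_eq_square field_simps)
  have sol: "y x = y 0 * cosh (k * x) + y' 0 / k * sinh (k * x)" if "x \<in> Ivl" for x
    using k that by (intro linear_hyperbolic_solution y y') auto
  have "y 1 = 1" "y (-1) = 1"
    by (simp_all add: y_def f_def X_boundary)
  then have "y 0 * cosh k + y' 0 / k * sinh k = 1" "y 0 * cosh k - y' 0 / k * sinh k = 1"
    using sol[of 1] sol[of "-1"] by simp_all
  then have "y' 0 / k * sinh k = 0" and y0: "y 0 * cosh k = 1" by linarith+
  then have y'0: "y' 0 = 0" using k by simp
  have "u = bratu_u0 k"
  proof (rule X_eqI)
    fix x assume x: "x \<in> Ivl"
    have "exp (- f x / 2) = cosh (k * x) / cosh k"
      using sol[OF x] y'0 y0 by (simp add: y_def field_simps)
    then have "ln (cosh (k * x) / cosh k) = - f x / 2"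
      by (metis ln_exp)
    then show "X_apply u x = X_apply (bratu_u0 k) x"
      using x by (simp add: bratu_u0.rep_eq bratu_fun_def f_def)
  qed
  moreover have "l = bratu_l0 k"
  proof -
    have "f' 0 = 0" using y'0 by (simp add: y'_def y_def)
    then have "l * exp (f 0) = 2 * k\<^sup>2" by (simp add: k E_def)
    moreover have "exp (f 0) * (y 0)\<^sup>2 = 1"
      by (simp add: y_def power2_eq_square flip: exp_add)
    ultimately have "l = 2 * k\<^sup>2 * (y 0)\<^sup>2" by (metis mult.assoc mult.right_neutral)
    moreover have "y 0 = 1 / cosh k" using y0 by (simp add: field_simps)
    ultimately show ?thesis by (simp add: bratu_l0_def power_divide)
  qed
  ultimately show ?thesis using k by (auto simp: bratu_path_def)
qed

lemma no_bifurcation_point: "\<not> bifurcation_point p"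
proof
  assume p: "bifurcation_point p"
  let ?N = "UNIV \<times> {0<..} :: (X \<times> real) set"
  have "open ?N" by (intro open_Times) auto
  moreover have "p \<in> ?N"
    using p by (auto simp: bifurcation_point_def bratu_path_def bratu_l0_def)
  ultimately obtain q where "q \<in> ?N" "bratu_F q = 0" "q \<notin> bratu_path"
    using p unfolding bifurcation_point_def by blast
  then show False using positive_solution_in_path[of "fst q" "snd q"] by auto
qed

theorem mainTheorem2:
  shows "(\<exists>!p. p \<in> bratu_path \<and> critical_point p) \<and>
    (\<forall>p\<in>bratu_path. critical_point p \<longrightarrow> limit_point p) \<and>
    (\<forall>p\<in>bratu_path. \<not> bifurcation_point p)"
proof (intro conjI ballI impI critical_imp_limit_point no_bifurcation_point)
  obtain \<alpha> where \<alpha>: "\<alpha> > 0" "even_mode \<alpha> 1 = 0"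
    and unique: "\<And>\<beta>. \<beta> > 0 \<Longrightarrow> even_mode \<beta> 1 = 0 \<Longrightarrow> \<beta> = \<alpha>"
    using even_mode_zero_unique by blast
  show "\<exists>!p. p \<in> bratu_path \<and> critical_point p"
  proof (rule ex1I)
    show "(bratu_u0 \<alpha>, bratu_l0 \<alpha>) \<in> bratu_path \<and> critical_point (bratu_u0 \<alpha>, bratu_l0 \<alpha>)"
      using \<alpha> by (auto simp: critical_point_iff bratu_path_def)
    fix q assume "q \<in> bratu_path \<and> critical_point q"
    then show "q = (bratu_u0 \<alpha>, bratu_l0 \<alpha>)"
      using unique by (auto simp: bratu_path_def critical_point_iff)
  qed
qed

end
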